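(* Every digraph with $n\ge 2$ vertices and at least $n^2-2n+2$ arcs contains a Hamilton directed cycle.
   Context: Digraphs are finite and strict: no loops and no parallel arcs in the same direction, but both arcs $uv$ and $vu$ may be present. A Hamilton directed cycle of a digraph is a directed cycle containing every vertex; for $n=2$, a directed cycle on two vertices $u,v$ consists of both arcs $uv$ and $vu$. *)

theory Defs
  imports "Graph_Theory.Arc_Walk"
begin

(* A cycle is a nonempty closed list of arcs, so each of its vertices is the tail of one of
   its arcs. Cycles of length two (uv followed by vu) are allowed. *)
definition hamilton_cycle :: "('a, 'b) pre_digraph \<Rightarrow> 'b awalk \<Rightarrow> bool" where
  "hamilton_cycle G p \<longleftrightarrow> pre_digraph.cycle G p \<and> set (map (tail G) p) = verts G"

end

(* At most n - 2 ordered pairs of distinct vertices are not joined by an arc. Induct on n: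
   delete a vertex v incident with such a missing pair, if there is one. Each of the at most
   n - 2 missing pairs at v blocks at most one of the n - 1 places where v could be inserted
   into a Hamilton cycle of the remaining vertices, so some place is free. *)
theory Submission
  imports Defs
begin

text \<open>Place \<open>i\<close> is the gap between \<open>zs ! i\<close> and
  \<open>zs ! Suc i\<close> of the closed list. If every gap were blocked, choosing a blocking pair
  for each would inject the gaps into \<open>M\<close>, against
  \<open>card M < length xs\<close>.\<close>

lemma exists_insertion_place:
  assumes "finite M" "distinct xs" "v \<notin> set xs" "card M < length xs"
    and succ: "successively (\<lambda>u w. (u, w) \<notin> M) (xs @ [hd xs])"
  shows "\<exists>ys. distinct ys \<and> set ys = insert v (set xs) \<and>
           successively (\<lambda>u w. (u, w) \<notin> M) (ys @ [hd ys])"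
proof -
  define zs where "zs = xs @ [hd xs]"
  have ne: "xs \<noteq> []" using assms(4) by auto
  \<comment> \<open>\<open>hd xs\<close> occurs in \<open>zs\<close> both first and last. The bound
    on the indices excludes the last occurrence here; for successors it excludes the first, so that
    a rotation of \<open>xs\<close> remains.\<close>
  have inj1: "i = j" if "zs ! i = zs ! j" "i < length xs" "j < length xs" for i j
    using that assms(2) by (simp add: zs_def nth_append nth_eq_iff_index_eq)
  have tl_zs: "tl zs = rotate1 xs"
    using ne by (cases xs) (auto simp: zs_def)
  have inj2: "i = j" if "zs ! Suc i = zs ! Suc j" "i < length xs" "j < length xs" for i j
  proof -
    have "tl zs ! i = tl zs ! j" using that by (simp add: nth_tl zs_def)
    then show ?thesis using that assms(2) unfolding tl_zs
      by (simp add: nth_eq_iff_index_eq)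
  qed
  have set_zs: "set zs = set xs" using ne by (auto simp: zs_def)
  then have nv: "zs ! i \<noteq> v" if "i \<le> length xs" for i
    using that assms(3) nth_mem[of i zs] by (auto simp: zs_def)
  have "\<exists>i < length xs. (zs ! i, v) \<notin> M \<and> (v, zs ! Suc i) \<notin> M"
  proof (rule ccontr)
    assume blocked: "\<not> ?thesis"
    \<comment> \<open>A pair ending in \<open>v\<close> determines its gap by its tail, a pair
      starting in \<open>v\<close> by its head. The two kinds never coincide, as \<open>v\<close> is
      not in \<open>zs\<close>.\<close>
    define h where "h i = (if (zs ! i, v) \<in> M then (zs ! i, v) else (v, zs ! Suc i))" for i
    have "inj_on h {..<length xs}"
      by (rule inj_onI) (auto simp: h_def nv Suc_leI dest: inj1 inj2 split: if_splits)
    moreover have "h ` {..<length xs} \<subseteq> M" using blocked by (auto simp: h_def)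
    ultimately have "length xs \<le> card M"
      using card_inj_on_le[of h "{..<length xs}" M] assms(1) by simp
    then show False using assms(4) by simp
  qed
  then obtain i where i: "i < length xs" "(zs ! i, v) \<notin> M" "(v, zs ! Suc i) \<notin> M" by blast
  \<comment> \<open>\<open>B\<close> is empty when the free gap is the closing one. Keeping
    \<open>hd xs\<close> at the end treats this case like the others, and \<open>A\<close> being
    nonempty preserves the head.\<close>
  define A where "A = take (Suc i) xs"
  define B where "B = drop (Suc i) xs"
  have AB: "xs = A @ B" by (simp add: A_def B_def)
  have zs: "zs = A @ (B @ [hd xs])" by (simp add: zs_def AB)
  have A: "A \<noteq> []" "length A = Suc i" using i(1) by (auto simp: A_def)
  have last: "last A = zs ! i" using A by (simp add: zs nth_append last_conv_nth)
  have hd: "hd (B @ [hd xs]) = zs ! Suc i" using A by (simp add: zs nth_append hd_conv_nth)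
  have "successively (\<lambda>u w. (u, w) \<notin> M) (A @ (B @ [hd xs]))"
    using succ zs by (simp add: zs_def)
  then have "successively (\<lambda>u w. (u, w) \<notin> M) (A @ v # (B @ [hd xs]))"
    using i last hd by (auto simp: successively_append_iff successively_Cons simp del: hd_append2)
  moreover have "hd (A @ v # B) = hd xs" using A by (simp add: AB)
  ultimately show ?thesis
    using assms(2,3) by (intro exI[of _ "A @ v # B"]) (auto simp: AB)
qed

text \<open>Working with a set \<open>M\<close> of forbidden pairs instead of a digraph makes vertex
  deletion a mere restriction of \<open>M\<close>. Deletion lowers \<open>card V\<close> by one, so
  \<open>M\<close> must lose a pair too, unless it is empty.\<close>

lemma cyclic_ordering_avoiding:
  assumes "finite V" "M \<subseteq> V \<times> V" "card V \<ge> 2" "card M + 2 \<le> card V"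
  shows "\<exists>xs. distinct xs \<and> set xs = V \<and> successively (\<lambda>u w. (u, w) \<notin> M) (xs @ [hd xs])"
  using assms
proof (induction "card V" arbitrary: V M)
  case 0
  then show ?case by simp
next
  case (Suc m)
  have finM: "finite M" using Suc.prems by (meson finite_SigmaI finite_subset)
  show ?case
  \<comment> \<open>The true base case is two vertices, where the bound forces \<open>M\<close> to
    be empty.\<close>
  proof (cases "m = 1")
    case True
    then have "card V = 2" using Suc.hyps by simp
    then obtain a b where ab: "V = {a, b}" "a \<noteq> b" by (auto simp: card_2_iff)
    have "M = {}" using Suc.prems \<open>card V = 2\<close> finM by simp
    then show ?thesis using ab by (intro exI[of _ "[a, b]"]) auto
  next
    case False
    \<comment> \<open>An endpoint of some forbidden pair, so that restricting \<open>M\<close> to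
      the other vertices is a strict loss; any vertex if \<open>M\<close> is empty.\<close>
    obtain v where v: "v \<in> V" "M \<noteq> {} \<Longrightarrow> M \<inter> (V - {v}) \<times> (V - {v}) \<noteq> M"
    proof (cases "M = {}")
      case True
      then show ?thesis using that Suc.prems(3) by (cases "V = {}") auto
    next
      case False
      then obtain a b where "(a, b) \<in> M" by auto
      then show ?thesis using that[of a] Suc.prems(2) by blast
    qed
    define M' where "M' = M \<inter> (V - {v}) \<times> (V - {v})"
    have cV: "card (V - {v}) = m" using v(1) Suc.hyps(2) Suc.prems(1) by simp
    have "card M' + 2 \<le> m"
    proof (cases "M = {}")
      case True
      then show ?thesis using False Suc.hyps Suc.prems(3) by (simp add: M'_def)
    next
      case False
      then have "M' \<subset> M" using v(2) by (auto simp: M'_def)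
      then have "card M' < card M" using finM by (rule psubset_card_mono[rotated])
      then show ?thesis using Suc.hyps(2) Suc.prems(4) by simp
    qed
    then obtain xs where xs: "distinct xs" "set xs = V - {v}"
      "successively (\<lambda>u w. (u, w) \<notin> M') (xs @ [hd xs])"
      using Suc.hyps(1)[of "V - {v}" M'] cV Suc.prems(1) by (auto simp: M'_def)
    have len: "length xs = m" using xs cV by (metis distinct_card)
    have "xs \<noteq> []" using len \<open>card M' + 2 \<le> m\<close> by auto
    then have "set (xs @ [hd xs]) = V - {v}"
      using hd_in_set[of xs] unfolding xs(2)[symmetric] by auto
    \<comment> \<open>All entries lie in \<open>V - {v}\<close>, where \<open>M\<close> and
      \<open>M'\<close> agree.\<close>
    then have "successively (\<lambda>u w. (u, w) \<notin> M) (xs @ [hd xs])"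
      by (intro successively_mono[OF xs(3)]) (simp only: M'_def, blast)
    moreover have "card M < length xs" "v \<notin> set xs"
      using len xs(2) Suc.hyps(2) Suc.prems(4) by simp_all
    ultimately obtain ys where "distinct ys" "set ys = insert v (set xs)"
      "successively (\<lambda>u w. (u, w) \<notin> M) (ys @ [hd ys])"
      using exists_insertion_place[OF finM xs(1)] by metis
    moreover have "insert v (set xs) = V" using xs(2) v(1) by auto
    ultimately show ?thesis by auto
  qed
qed

text \<open>Library walks are lists of arcs, so an arc is chosen for each consecutive pair of
  vertices.\<close>

lemma (in wf_digraph) awalk_of_successively:
  assumes "xs \<noteq> []" "set xs \<subseteq> verts G" "successively (dominates G) xs"
  shows "\<exists>p. awalk (hd xs) p (last xs) \<and> awalk_verts (hd xs) p = xs"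
  using assms
proof (induction xs rule: induct_list012)
  case (2 x)
  then show ?case by (intro exI[of _ "[]"]) (simp add: awalk_Nil_iff)
next
  case (3 x y zs)
  then obtain p where p: "awalk y p (last (y # zs))" "awalk_verts y p = y # zs" by auto
  obtain e where "e \<in> arcs G" "tail G e = x" "head G e = y"
    using "3.prems" by (auto elim: reachableE)
  then show ?case using p by (intro exI[of _ "e # p"]) (auto simp: awalk_Cons_iff)
qed simp

theorem corollary1p2:
  fixes G :: "('a, 'b) pre_digraph" and n :: nat
  assumes "digraph G"
    and "card (verts G) = n"
    and "n \<ge> 2"
    and "int (card (arcs G)) \<ge> int n ^ 2 - 2 * int n + 2"
  shows "\<exists>p. hamilton_cycle G p"
proof -
  interpret digraph G by fact
  define V where "V = verts G"
  define L where "L = (\<lambda>u. (u, u)) ` V"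
  define M where "M = V \<times> V - L - arcs_ends G"
  have fin: "finite V" by (simp add: V_def)
  have cV: "card V = n" using assms(2) by (simp add: V_def)
  have cL: "card L = n" unfolding L_def cV[symmetric] by (rule card_image) (simp add: inj_on_def)
  have sub: "arcs_ends G \<subseteq> V \<times> V - L"
    by (auto simp: V_def L_def dest: adj_in_verts adj_not_same)
  \<comment> \<open>There are no parallel arcs, so arcs can be counted as ordered pairs.\<close>
  have cA: "card (arcs_ends G) = card (arcs G)"
    unfolding arcs_ends_def by (rule card_image[OF inj_on_arc_to_ends])
  have "L \<subseteq> V \<times> V" by (auto simp: L_def)
  then have "card (V \<times> V) = card L + card (V \<times> V - L)"
    using fin by (metis card_Diff_subset card_mono finite_SigmaI finite_subset le_add_diff_inverse)
  moreover have "card (V \<times> V - L) = card (arcs_ends G) + card M"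
    unfolding M_def using fin sub
    by (metis card_Diff_subset card_mono finite_Diff finite_SigmaI finite_subset
        le_add_diff_inverse)
  \<comment> \<open>The ordered pairs split into loops, arcs and missing pairs; with the assumed
    bound on the arcs this leaves at most \<open>n - 2\<close> missing pairs.\<close>
  ultimately have "n * n = n + card (arcs G) + card M"
    by (simp add: card_cartesian_product cV cL cA)
  then have "int n ^ 2 = int n + int (card (arcs G)) + int (card M)"
    by (metis of_nat_add of_nat_mult power2_eq_square)
  then have "card M + 2 \<le> card V" using assms(4) cV by linarith
  moreover have "M \<subseteq> V \<times> V" by (auto simp: M_def)
  ultimately obtain xs where xs: "distinct xs" "set xs = V"
    "successively (\<lambda>u w. (u, w) \<notin> M) (xs @ [hd xs])"
    using cyclic_ordering_avoiding[OF fin] cV assms(3) by blast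
  have len: "length xs \<ge> 2" using xs cV assms(3) by (metis distinct_card)
  then obtain a b cs where abc: "xs = a # b # cs"
    by (metis Suc_le_length_iff numeral_2_eq_2)
  \<comment> \<open>\<open>M\<close> omits the diagonal, so a pair outside \<open>M\<close> is an
    arc only if its entries differ. For the closing pair this uses that \<open>xs\<close> has at
    least two entries.\<close>
  have "last xs \<noteq> hd xs"
    using xs(1) last_in_set[of "b # cs"] by (auto simp: abc simp del: last_in_set)
  moreover have "successively (\<noteq>) xs"
    using xs(1) by (simp add: successively_conv_nth nth_eq_iff_index_eq)
  ultimately have "successively (\<noteq>) (xs @ [hd xs])"
    by (simp add: successively_append_iff)
  with xs(3) have "successively (\<lambda>u w. (u, w) \<notin> M \<and> u \<noteq> w) (xs @ [hd xs])"
    by (simp only: successively_conv_nth) blast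
  then have "successively (dominates G) (xs @ [hd xs])"
    by (rule successively_mono) (use xs(2) in \<open>auto simp: M_def L_def abc\<close>)
  moreover have "set (xs @ [hd xs]) \<subseteq> verts G"
    using xs(2) by (auto simp: V_def abc)
  ultimately obtain p where p: "awalk (hd xs) p (hd xs)" "awalk_verts (hd xs) p = xs @ [hd xs]"
    using awalk_of_successively[of "xs @ [hd xs]"] by (auto simp: abc)
  then have "p \<noteq> []" by (auto simp: abc)
  \<comment> \<open>The vertices of a nonempty walk are the tails of its arcs followed by the final
    head, here the repeated \<open>hd xs\<close>.\<close>
  moreover from this p(2) have "map (tail G) p = xs" by (simp add: awalk_verts_conv)
  moreover have "distinct (tl (xs @ [hd xs]))" using xs(1) by (auto simp: abc)
  ultimately have "hamilton_cycle G p"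
    using p xs(2) unfolding hamilton_cycle_def cycle_def V_def by auto
  then show ?thesis by blast
qed

end
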